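(* Let $n,d$ be integers with $1\le d\le n$. If $2\lceil d/2\rceil > n-d$, then the $(n,d)$ Delsarte linear program has a unique optimum, namely the vector $A^*=(A^*_0,\dots,A^*_n)$ given, when $d$ is even, by \[ A^*_i = \begin{cases} 1 & \text{if } i=0 \\ \frac{n}{2d-n} & \text{if } i=d \\ 0 & \text{otherwise,} \end{cases} \] and, when $d$ is odd, by \[ A^*_i = \begin{cases} 1 & \text{if } i=0 \\ \frac{d+1}{2d-n+1} & \text{if } i=d \\ \frac{n-d}{2d-n+1} & \text{if } i = d+1 \\ 0 & \text{otherwise.} \end{cases} \]
   Context: $[a,b]=\{x\in\mathbb{Z}: a\le x\le b\}$ and $[a]=\{1,\dots,a\}$ (empty if $a\le 0$). $\binom{a}{b}=0$ unless $0\le b\le a$. For $0\le i,j\le n$, the Krawtchouk polynomial is $K_j(i)=K_j(i;n)=\sum_{k=0}^j(-1)^k\binom{i}{k}\binom{n-i}{j-k}$. For integers $1\le d\le n$, the $(n,d)$ Delsarte linear program, in real variables $A=(A_0,\dots,A_n)$, is: maximize $\sum_{i=0}^n A_i$ subject to $\sum_{i=0}^n A_iK_j(i)\ge 0$ for all $j\in[n]$; $A_i=0$ for all $i\in[d-1]$; $A_0=1$; $A_i\ge 0$ for all $i\in[n]$. An optimum is a feasible point achieving the optimal objective value. *)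

theory Defs
  imports Complex_Main "HOL-Library.FuncSet"
begin

text \<open>Only meaningful for \<open>i \<le> n\<close>, since \<open>n - i\<close> is a truncated difference of naturals.\<close>

definition krawtchouk :: "nat \<Rightarrow> nat \<Rightarrow> nat \<Rightarrow> real" where
  "krawtchouk n j i = (\<Sum>k = 0..j. (-1) ^ k * real (i choose k) * real ((n - i) choose (j - k)))"

text \<open>
  A vector \<open>(A\<^sub>0, \<dots>, A\<^sub>n)\<close> is an extensional function on \<open>{0..n}\<close> (it is \<open>undefined\<close> outside
  this index set), so that equality of functions is equality of vectors.
\<close>

definition delsarte_feasible :: "nat \<Rightarrow> nat \<Rightarrow> (nat \<Rightarrow> real) \<Rightarrow> bool" where
  "delsarte_feasible n d A \<longleftrightarrow>
     A \<in> {0..n} \<rightarrow>\<^sub>E UNIV \<and>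
     (\<forall>j \<in> {1..n}. (\<Sum>i = 0..n. A i * krawtchouk n j i) \<ge> 0) \<and>
     (\<forall>i \<in> {1..d - 1}. A i = 0) \<and>
     A 0 = 1 \<and>
     (\<forall>i \<in> {1..n}. A i \<ge> 0)"

definition delsarte_objective :: "nat \<Rightarrow> (nat \<Rightarrow> real) \<Rightarrow> real" where
  "delsarte_objective n A = (\<Sum>i = 0..n. A i)"

definition delsarte_optimum :: "nat \<Rightarrow> nat \<Rightarrow> (nat \<Rightarrow> real) \<Rightarrow> bool" where
  "delsarte_optimum n d A \<longleftrightarrow> is_arg_max (delsarte_objective n) (delsarte_feasible n d) A"

text \<open>For odd \<open>d = n\<close> the index \<open>d + 1\<close> lies outside \<open>{0..n}\<close> and that case is vacuous.\<close>

definition delsarte_star :: "nat \<Rightarrow> nat \<Rightarrow> nat \<Rightarrow> real" where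
  "delsarte_star n d = (\<lambda>i \<in> {0..n}.
     if even d then
       (if i = 0 then 1
        else if i = d then real n / (2 * real d - real n)
        else 0)
     else
       (if i = 0 then 1
        else if i = d then (real d + 1) / (2 * real d - real n + 1)
        else if i = d + 1 then (real n - real d) / (2 * real d - real n + 1)
        else 0))"

end

theory Submission
  imports Defs "HOL-Computational_Algebra.Polynomial"
begin

text \<open>
  Write \<open>K\<^sub>j(i)\<close> for \<^term>\<open>krawtchouk n j i\<close>.

  The upper bound is Plotkin's averaging argument, that is, a dual certificate. For even \<open>d\<close>,
  the constraint \<open>j = 1\<close> reads \<open>\<Sum>i. A i * (n - 2 * i) \<ge> 0\<close>. All the weights with \<open>i \<ge> d\<close> are at
  most \<open>- (2 * d - n) < 0\<close>, and this value is attained at \<open>i = d\<close> only. Since the index \<open>0\<close>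
  contributes just \<open>n\<close>, the remaining mass is at most \<open>n / (2 * d - n)\<close>, with equality only if it
  is concentrated at \<open>d\<close>. For odd \<open>d\<close> the sum of the constraints \<open>j = 1\<close> and \<open>j = n\<close> is used; its
  weights \<open>n - 2 * i + (-1) ^ i\<close> are those of the first constraint for the parameters
  \<open>(n + 1, d + 1)\<close> after appending a parity bit. The weights at \<open>d\<close> and \<open>d + 1\<close> now tie, so the total
  only forces the mass onto these two indices, and the two constraints taken separately
  determine how it is shared. Both cases are instances of \<open>delsarte_objective_bound\<close>.

  The substance is the feasibility of the claimed optimum. For even \<open>d\<close> this amounts to
  \<open>n * K\<^sub>j(d) \<ge> - (2 * d - n) * (n choose j)\<close> for \<open>1 \<le> j \<le> n\<close>. With \<open>e = n - d\<close> and
  \<open>m = 2 * d - n\<close>, the number \<open>K\<^sub>j(d)\<close> is the coefficient of \<open>z ^ j\<close> in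
  \<open>(1 - z) ^ d * (1 + z) ^ (n - d) = (1 - z\<^sup>2) ^ e * (1 - z) ^ m\<close>. Induction on \<open>e\<close>, splitting off one
  factor \<open>1 - z\<^sup>2\<close> at a time, bounds it in absolute value for \<open>0 < j < n\<close>
  (\<open>coeff_krawtchouk_poly_bound\<close>); at \<open>j = n\<close> the value is \<open>(-1) ^ d = 1\<close>. For odd \<open>d\<close> the claimed
  optimum is the one for \<open>(n + 1, d + 1)\<close> averaged over the deletion of one coordinate, and
  \<open>krawtchouk_puncture\<close> carries the inequality over.
\<close>

section \<open>Krawtchouk polynomials as coefficients\<close>

definition krawtchouk_poly :: "nat \<Rightarrow> nat \<Rightarrow> real poly" where
  "krawtchouk_poly a b = [:1, -1:] ^ a * [:1, 1:] ^ b"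

lemma coeff_one_plus_power: "coeff ([:1, c:] ^ n) k = real (n choose k) * c ^ k"
proof (cases "k \<le> n")
  case True
  then show ?thesis by (simp add: coeff_linear_poly_power)
next
  case False
  have "degree ([:1, c:] ^ n) \<le> degree [:1, c:] * n" by (rule degree_power_le)
  also have "\<dots> \<le> 1 * n" by (intro mult_right_mono) simp_all
  finally have "coeff ([:1, c:] ^ n) k = 0" using False by (intro coeff_eq_0) simp
  with False show ?thesis by (simp add: binomial_eq_0)
qed

lemma krawtchouk_eq_coeff: "krawtchouk n j i = coeff (krawtchouk_poly i (n - i)) j"
  by (simp add: krawtchouk_def krawtchouk_poly_def coeff_mult coeff_one_plus_power
      atLeast0AtMost mult_ac)

lemma coeff_krawtchouk_poly_Suc_right:
  "coeff (krawtchouk_poly a (Suc b)) (Suc j)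
     = coeff (krawtchouk_poly a b) (Suc j) + coeff (krawtchouk_poly a b) j"
proof -
  have "krawtchouk_poly a (Suc b) = [:1, 1:] * krawtchouk_poly a b"
    by (simp only: krawtchouk_poly_def power_Suc mult_ac)
  then show ?thesis by simp
qed

lemma coeff_krawtchouk_poly_Suc_left:
  "coeff (krawtchouk_poly (Suc a) b) (Suc j)
     = coeff (krawtchouk_poly a b) (Suc j) - coeff (krawtchouk_poly a b) j"
proof -
  have "krawtchouk_poly (Suc a) b = [:1, -1:] * krawtchouk_poly a b"
    by (simp only: krawtchouk_poly_def power_Suc mult_ac)
  then show ?thesis by simp
qed

lemma coeff_krawtchouk_poly_Suc_Suc:
  "coeff (krawtchouk_poly (Suc a) (Suc b)) (Suc (Suc j))
     = coeff (krawtchouk_poly a b) (Suc (Suc j)) - coeff (krawtchouk_poly a b) j"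
  by (simp add: coeff_krawtchouk_poly_Suc_left coeff_krawtchouk_poly_Suc_right)

lemma krawtchouk_poly_0_right: "coeff (krawtchouk_poly a 0) j = (-1) ^ j * real (a choose j)"
  by (simp add: krawtchouk_poly_def coeff_one_plus_power)

lemma coeff_0_krawtchouk_poly: "coeff (krawtchouk_poly a b) 0 = 1"
  by (simp add: krawtchouk_poly_def coeff_mult_0 coeff_0_power)

lemma coeff_1_krawtchouk_poly: "coeff (krawtchouk_poly a b) (Suc 0) = real b - real a"
proof (induction b)
  case 0
  show ?case by (simp add: krawtchouk_poly_0_right)
next
  case (Suc b)
  then show ?case
    using coeff_krawtchouk_poly_Suc_right[of a b 0] by (simp add: coeff_0_krawtchouk_poly)
qed

lemma coeff_2_krawtchouk_poly:
  "2 * coeff (krawtchouk_poly a b) 2 = (real b - real a)\<^sup>2 - (real a + real b)"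
proof (induction b)
  case 0
  have "2 * real (a choose 2) = real a * (real a - 1)"
    by (induction a) (simp_all add: numeral_2_eq_2 algebra_simps)
  then show ?case by (simp add: krawtchouk_poly_0_right power2_eq_square algebra_simps)
next
  case (Suc b)
  then show ?case
    using coeff_krawtchouk_poly_Suc_right[of a b 1]
    by (simp add: coeff_1_krawtchouk_poly numeral_2_eq_2 algebra_simps)
qed

lemma degree_krawtchouk_poly: "degree (krawtchouk_poly a b) = a + b"
  by (simp add: krawtchouk_poly_def degree_mult_eq degree_power_eq)

text \<open>
  Reversing the order of the coefficients fixes \<open>1 + z\<close> and negates \<open>1 - z\<close>.
\<close>

lemma coeff_krawtchouk_poly_reflect:
  assumes "j \<le> a + b"
  shows "coeff (krawtchouk_poly a b) (a + b - j) = (-1) ^ a * coeff (krawtchouk_poly a b) j"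
proof -
  have *: "reflect_poly [:1, -1 :: real:] = [:-1:] * [:1, -1:]"
    "reflect_poly [:1, 1 :: real:] = [:1, 1:]"
    by (simp_all add: reflect_poly_def)
  have "reflect_poly (krawtchouk_poly a b) = [:-1:] ^ a * krawtchouk_poly a b"
    unfolding krawtchouk_poly_def reflect_poly_mult reflect_poly_power * power_mult_distrib
    by (rule mult.assoc)
  also have "[:-1 :: real:] ^ a = [:(-1) ^ a:]"
    by (simp add: poly_const_pow)
  finally have "coeff (reflect_poly (krawtchouk_poly a b)) j
      = (-1) ^ a * coeff (krawtchouk_poly a b) j"
    by simp
  with assms show ?thesis
    by (simp add: coeff_reflect_poly degree_krawtchouk_poly)
qed

lemma krawtchouk_1: "i \<le> n \<Longrightarrow> krawtchouk n (Suc 0) i = real n - 2 * real i"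
  using coeff_1_krawtchouk_poly[of i "n - i"] by (simp add: krawtchouk_eq_coeff of_nat_diff)

lemma krawtchouk_n: "i \<le> n \<Longrightarrow> krawtchouk n n i = (-1) ^ i"
  using coeff_krawtchouk_poly_reflect[of 0 i "n - i"]
  by (simp add: krawtchouk_eq_coeff coeff_0_krawtchouk_poly)

lemma krawtchouk_0: "krawtchouk n j 0 = real (n choose j)"
  by (simp add: krawtchouk_eq_coeff krawtchouk_poly_def coeff_one_plus_power)

section \<open>A bound on Krawtchouk values\<close>

text \<open>
  The ratios \<open>(N choose k) / (N choose (k + 1))\<close> and \<open>(N choose (k + 2)) / (N choose (k + 1))\<close> are
  \<open>(k + 1) / (N - k)\<close> and \<open>(N - k - 1) / (k + 2)\<close>, so even their numerators add up to only \<open>N\<close>.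
\<close>

lemma binomial_neighbours_le:
  assumes "k < N"
  shows "real (N choose k) + real (N choose Suc (Suc k)) \<le> real N * real (N choose Suc k)"
proof -
  have lower: "(N choose k) \<le> Suc k * (N choose Suc k)"
  proof -
    have "1 * (N choose k) \<le> (N - k) * (N choose k)"
      using assms by (intro mult_right_mono) simp_all
    also have "\<dots> = Suc k * (N choose Suc k)"
      by (simp only: binomial_absorb_comp binomial_absorption)
    finally show ?thesis by simp
  qed
  have upper: "(N choose Suc (Suc k)) \<le> (N - Suc k) * (N choose Suc k)"
  proof -
    have "1 * (N choose Suc (Suc k)) \<le> Suc (Suc k) * (N choose Suc (Suc k))"
      by (intro mult_right_mono) simp_all
    also have "\<dots> = (N - Suc k) * (N choose Suc k)"
      by (simp only: binomial_absorb_comp binomial_absorption)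
    finally show ?thesis by simp
  qed
  have "Suc k + (N - Suc k) = N" using assms by simp
  then have "Suc k * (N choose Suc k) + (N - Suc k) * (N choose Suc k) = N * (N choose Suc k)"
    by (metis add_mult_distrib)
  with lower upper have "(N choose k) + (N choose Suc (Suc k)) \<le> N * (N choose Suc k)"
    by linarith
  then show ?thesis by (metis of_nat_add of_nat_le_iff of_nat_mult)
qed

text \<open>
  At \<open>j = 1\<close> there is equality. At \<open>j = 2\<close>, with \<open>n = 2 * e + m\<close>, the coefficient is
  \<open>(m\<^sup>2 - n) / 2\<close> and the claim \<open>\<bar>m\<^sup>2 - n\<bar> \<le> m * (n - 1)\<close> splits into \<open>(m - 1) * (n + m) \<ge> 0\<close> and
  \<open>(m + 1) * (n - m) \<ge> 0\<close>.
\<close>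

lemma coeff_krawtchouk_poly_bound_low:
  assumes "1 \<le> m" and "j = 1 \<or> j = 2"
  shows "real (2 * e + m) * \<bar>coeff (krawtchouk_poly (e + m) e) j\<bar>
           \<le> real m * real ((2 * e + m) choose j)"
  using assms(2)
proof
  assume "j = 1"
  then show ?thesis by (simp add: coeff_1_krawtchouk_poly)
next
  assume j: "j = 2"
  define n m' where "n = real (2 * e + m)" and "m' = real m"
  have m': "1 \<le> m'" "m' \<le> n" using assms(1) by (simp_all add: n_def m'_def)
  have c: "2 * coeff (krawtchouk_poly (e + m) e) 2 = m'\<^sup>2 - n"
    using coeff_2_krawtchouk_poly[of "e + m" e]
    by (simp add: n_def m'_def)
  have "0 \<le> (m' - 1) * (n + m')" "0 \<le> m' * (n - m') + (n - m')" using m' by simp_all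
  then have "\<bar>m'\<^sup>2 - n\<bar> \<le> m' * (n - 1)"
    unfolding abs_le_iff by (simp add: power2_eq_square algebra_simps)
  then have "n * (2 * \<bar>coeff (krawtchouk_poly (e + m) e) 2\<bar>) \<le> n * (m' * (n - 1))"
    using m' unfolding c[symmetric] by (intro mult_left_mono) (simp_all add: abs_mult)
  moreover have "2 * real ((2 * e + m) choose 2) = n * (n - 1)"
    using coeff_2_krawtchouk_poly[of 0 "2 * e + m"]
    by (simp add: n_def krawtchouk_poly_def coeff_one_plus_power power2_eq_square algebra_simps)
  ultimately have "2 * (n * \<bar>coeff (krawtchouk_poly (e + m) e) 2\<bar>)
      \<le> 2 * (m' * real ((2 * e + m) choose 2))"
    by (simp only: mult.left_commute)
  then show ?thesis by (simp add: j n_def m'_def)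
qed

text \<open>
  For \<open>d = e + m\<close> and \<open>n = 2 * e + m\<close> this says \<open>\<bar>K\<^sub>j(d)\<bar> / (n choose j) \<le> \<bar>K\<^sub>1(d)\<bar> / n\<close>. Passing from
  \<open>e\<close> to \<open>e + 1\<close> multiplies the polynomial by \<open>1 - z\<^sup>2\<close>, so its \<open>j\<close>-th coefficient becomes the
  difference of the old ones at \<open>j\<close> and \<open>j - 2\<close>. The induction hypothesis covers both unless
  \<open>j\<close> is within distance \<open>2\<close> of an end of the range; those \<open>j\<close> are treated directly, up to
  reflection.
\<close>

lemma coeff_krawtchouk_poly_bound:
  assumes "1 \<le> m" and "1 \<le> j" and "j < 2 * e + m"
  shows "real (2 * e + m) * \<bar>coeff (krawtchouk_poly (e + m) e) j\<bar>
           \<le> real m * real ((2 * e + m) choose j)"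
  using assms(2,3)
proof (induction e arbitrary: j)
  case 0
  then show ?case by (simp add: krawtchouk_poly_0_right abs_mult)
next
  case (Suc e)
  let ?n = "2 * Suc e + m" and ?N = "2 * e + m"
  consider "j = 1 \<or> j = 2" | "?n - j = 1 \<or> ?n - j = 2" | "3 \<le> j" "j + 3 \<le> ?n"
    using Suc.prems by linarith
  then show ?case
  proof cases
    case 1
    then show ?thesis by (rule coeff_krawtchouk_poly_bound_low[OF assms(1)])
  next
    case 2
    have "\<bar>coeff (krawtchouk_poly (Suc e + m) (Suc e)) (?n - j)\<bar>
        = \<bar>coeff (krawtchouk_poly (Suc e + m) (Suc e)) j\<bar>"
      using coeff_krawtchouk_poly_reflect[of j "Suc e + m" "Suc e"] Suc.prems
      by (simp add: abs_mult mult_2 add_ac)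
    moreover have "?n choose (?n - j) = ?n choose j"
      using Suc.prems by (simp add: binomial_symmetric[symmetric])
    ultimately show ?thesis
      using coeff_krawtchouk_poly_bound_low[OF assms(1) 2, of "Suc e"] by simp
  next
    case 3
    then obtain k where k: "j = Suc (Suc k)" "1 \<le> k" "Suc (Suc k) < ?N"
      by (cases j; cases "j - 1") auto
    let ?c = "\<lambda>i. coeff (krawtchouk_poly (e + m) e) i"
    let ?B = "\<lambda>i. real (?N choose i)"
    have "\<bar>coeff (krawtchouk_poly (Suc e + m) (Suc e)) j\<bar> \<le> \<bar>?c j\<bar> + \<bar>?c k\<bar>"
      using coeff_krawtchouk_poly_Suc_Suc[of "e + m" e k] by (simp add: k)
    then have "?N * \<bar>coeff (krawtchouk_poly (Suc e + m) (Suc e)) j\<bar>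
        \<le> ?N * \<bar>?c j\<bar> + ?N * \<bar>?c k\<bar>"
      by (simp add: mult_left_mono flip: distrib_left)
    also have "\<dots> \<le> m * ?B j + m * ?B k"
      using k by (intro add_mono Suc.IH) simp_all
    finally have "?n * (?N * \<bar>coeff (krawtchouk_poly (Suc e + m) (Suc e)) j\<bar>)
        \<le> ?n * (m * ?B j + m * ?B k)"
      by (rule mult_left_mono) simp
    \<comment> \<open>With \<open>?n = ?N + 2\<close> and Pascal's rule applied twice to \<open>?n choose j\<close>, what is left to show
      is that the two outer binomials are dominated by \<open>?N\<close> times the middle one.\<close>
    also have "\<dots> = m * (?N * (?B j + ?B k) + 2 * (?B k + ?B j))"
      by (simp add: algebra_simps)
    also have "\<dots> \<le> m * (?N * (?B j + ?B k) + 2 * (?N * ?B (Suc k)))"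
      using binomial_neighbours_le[of k ?N] k by (intro mult_left_mono add_left_mono) simp_all
    also have "\<dots> = ?N * (m * real (?n choose j))"
      by (simp add: k algebra_simps)
    finally have "real ?N * (?n * \<bar>coeff (krawtchouk_poly (Suc e + m) (Suc e)) j\<bar>)
        \<le> real ?N * (m * real (?n choose j))"
      by (simp only: mult.left_commute)
    moreover have "0 < real ?N" using k by simp
    ultimately show ?thesis by (simp only: mult_le_cancel_left_pos)
  qed
qed

text \<open>
  At \<open>j = n\<close> the two-sided bound breaks down for \<open>d < n\<close>, and the sign of \<open>K\<^sub>n(d) = (-1) ^ d\<close>
  decides; this is where \<open>d\<close> has to be even.
\<close>

lemma krawtchouk_even_ge:
  assumes "even d" and "d \<le> n" and "n < 2 * d" and "1 \<le> j" and "j \<le> n"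
  shows "- (2 * real d - real n) * real (n choose j) \<le> real n * krawtchouk n j d"
proof (cases "j = n")
  case True
  then show ?thesis using assms by (simp add: krawtchouk_n)
next
  case False
  define e m where "e = n - d" and "m = 2 * d - n"
  have em: "d = e + m" "n = 2 * e + m" "n - d = e" "1 \<le> m"
    using assms by (simp_all add: e_def m_def)
  have m: "real m = 2 * real d - real n" using assms by (simp add: m_def)
  have "real n * \<bar>krawtchouk n j d\<bar> \<le> real m * real (n choose j)"
    using coeff_krawtchouk_poly_bound[of m j e] assms False em
    by (simp add: krawtchouk_eq_coeff)
  moreover have "real n * - krawtchouk n j d \<le> real n * \<bar>krawtchouk n j d\<bar>"
    by (intro mult_left_mono) simp_all
  ultimately have "- (real m * real (n choose j)) \<le> real n * krawtchouk n j d" by linarith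
  then show ?thesis by (simp only: m mult_minus_left)
qed

section \<open>Deleting a coordinate\<close>

lemma binomial_absorb_comp_real:
  "(real n + 1 - real j) * real (Suc n choose j) = (real n + 1) * real (n choose j)"
proof (cases "j \<le> Suc n")
  case True
  then show ?thesis
    using arg_cong[OF binomial_absorb_comp[of "Suc n" j], of real]
    unfolding of_nat_mult of_nat_diff[OF True] by (simp add: add.commute)
qed (simp add: binomial_eq_0)

text \<open>
  In terms of \<open>Q = (1 - z) ^ (a + 1) * (1 + z) ^ b\<close> of degree \<open>N = a + b + 1\<close>, both sides are the
  \<open>j\<close>-th coefficient of \<open>N * Q - z * Q'\<close>. The right-hand side is an unrestricted real
  difference, so the identity holds for every \<open>j\<close>, and the recurrence in \<open>b\<close> proves it by
  adding the instances \<open>j\<close> and \<open>j - 1\<close>. At \<open>b = 0\<close> the truncated \<open>b - 1\<close> is harmless because its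
  term is multiplied by \<open>0\<close>.
\<close>

lemma coeff_krawtchouk_poly_puncture:
  "(real a + 1) * coeff (krawtchouk_poly a b) j
     + real b * coeff (krawtchouk_poly (Suc a) (b - 1)) j
   = (real a + real b + 1 - real j) * coeff (krawtchouk_poly (Suc a) b) j"
proof (induction b arbitrary: j)
  case 0
  show ?case
    using binomial_absorb_comp_real[of a j]
    by (simp add: krawtchouk_poly_0_right mult.left_commute)
next
  case (Suc b)
  show ?case
  proof (cases j)
    case 0
    then show ?thesis by (simp add: coeff_0_krawtchouk_poly)
  next
    case (Suc i)
    have pred: "real b * coeff (krawtchouk_poly (Suc a) (b - 1)) (Suc i)
        + real b * coeff (krawtchouk_poly (Suc a) (b - 1)) i
        = real b * coeff (krawtchouk_poly (Suc a) b) (Suc i)"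
      by (cases b) (simp_all add: coeff_krawtchouk_poly_Suc_right distrib_left)
    show ?thesis
      using pred Suc.IH[of i] Suc.IH[of "Suc i"]
      by (simp add: Suc coeff_krawtchouk_poly_Suc_right algebra_simps)
  qed
qed

text \<open>
  Deleting a coordinate of a word of length \<open>n + 1\<close> and weight \<open>d + 1\<close> leaves weight \<open>d\<close> in
  \<open>d + 1\<close> cases and weight \<open>d + 1\<close> in \<open>n - d\<close> cases, and a \<open>j\<close>-set of coordinates survives
  \<open>n + 1 - j\<close> of the deletions. Counting with signs gives the identity.
\<close>

lemma krawtchouk_puncture:
  assumes "d \<le> n"
  shows "(real d + 1) * krawtchouk n j d + (real n - real d) * krawtchouk n j (d + 1)
           = (real n + 1 - real j) * krawtchouk (n + 1) j (d + 1)"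
  using coeff_krawtchouk_poly_puncture[of d "n - d" j] assms
  by (simp add: krawtchouk_eq_coeff of_nat_diff)

section \<open>Feasibility of the claimed optimum\<close>

lemma sum_delsarte_star_even:
  assumes "even d" and "1 \<le> d" and "d \<le> n"
  shows "(\<Sum>i = 0..n. delsarte_star n d i * f i)
           = f 0 + real n / (2 * real d - real n) * f d"
proof -
  have "(\<Sum>i = 0..n. delsarte_star n d i * f i) = (\<Sum>i \<in> {0, d}. delsarte_star n d i * f i)"
    using assms by (intro sum.mono_neutral_right) (auto simp: delsarte_star_def)
  then show ?thesis using assms by (simp add: delsarte_star_def)
qed

text \<open>
  For \<open>d = n\<close> the index \<open>d + 1\<close> falls outside the range of summation, and its coefficient on the
  right vanishes, so the formula covers that case too, whatever \<open>f (d + 1)\<close> is.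
\<close>

lemma sum_delsarte_star_odd:
  assumes "odd d" and "d \<le> n"
  shows "(\<Sum>i = 0..n. delsarte_star n d i * f i)
           = f 0 + (real d + 1) / (2 * real d - real n + 1) * f d
             + (real n - real d) / (2 * real d - real n + 1) * f (d + 1)"
proof -
  have "(\<Sum>i = 0..n. delsarte_star n d i * f i)
      = (\<Sum>i \<in> {0, d, d + 1} \<inter> {0..n}. delsarte_star n d i * f i)"
    using assms by (intro sum.mono_neutral_right) (auto simp: delsarte_star_def)
  also have "{0, d, d + 1} \<inter> {0..n} = (if d = n then {0, d} else {0, d, d + 1})"
    using assms by auto
  finally show ?thesis using assms odd_pos[of d] by (auto simp: delsarte_star_def)
qed

lemma delsarte_star_nonneg:
  assumes "d \<le> n" and "even d \<longrightarrow> n < 2 * d" and "odd d \<longrightarrow> n < 2 * d + 1" and "i \<in> {1..n}"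
  shows "0 \<le> delsarte_star n d i"
  using assms by (auto simp: delsarte_star_def)

lemma delsarte_star_feasible_even:
  assumes "even d" and "1 \<le> d" and "d \<le> n" and "n < 2 * d"
  shows "delsarte_feasible n d (delsarte_star n d)"
  unfolding delsarte_feasible_def
proof (intro conjI ballI)
  fix j assume j: "j \<in> {1..n}"
  have m: "0 < 2 * real d - real n" using assms by linarith
  have "- (2 * real d - real n) * real (n choose j) \<le> real n * krawtchouk n j d"
    using assms j by (intro krawtchouk_even_ge) auto
  then have "0 \<le> real (n choose j) + real n / (2 * real d - real n) * krawtchouk n j d"
    using m by (simp add: field_simps)
  then show "0 \<le> (\<Sum>i = 0..n. delsarte_star n d i * krawtchouk n j i)"
    using assms by (simp add: sum_delsarte_star_even krawtchouk_0)
qed (use assms in \<open>auto simp: delsarte_star_nonneg\<close>, auto simp: delsarte_star_def)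

text \<open>
  The inequality for \<open>(n + 1, d + 1)\<close> is transported by \<open>krawtchouk_puncture\<close>: the factor
  \<open>n + 1 - j\<close> produced there is exactly what turns \<open>(n + 1) choose j\<close> into
  \<open>(n + 1) * (n choose j)\<close>.
\<close>

lemma delsarte_star_feasible_odd:
  assumes "odd d" and "d \<le> n" and "n < 2 * d + 1"
  shows "delsarte_feasible n d (delsarte_star n d)"
  unfolding delsarte_feasible_def
proof (intro conjI ballI)
  fix j assume j: "j \<in> {1..n}"
  define m where "m = 2 * real d - real n + 1"
  have m: "0 < m" using assms by (simp add: m_def)
  let ?K = "krawtchouk (n + 1) j (d + 1)"
  have "- m * real ((n + 1) choose j) \<le> (real n + 1) * ?K"
    using krawtchouk_even_ge[of "d + 1" "n + 1" j] assms j by (simp add: m_def algebra_simps)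
  then have "(real n + 1 - real j) * (- m * real ((n + 1) choose j))
      \<le> (real n + 1 - real j) * ((real n + 1) * ?K)"
    using j by (intro mult_left_mono) auto
  moreover have "(real n + 1 - real j) * real ((n + 1) choose j)
      = (real n + 1) * real (n choose j)"
    using binomial_absorb_comp_real[of n j] by simp
  ultimately have "(real n + 1) * (- m * real (n choose j))
      \<le> (real n + 1) * ((real n + 1 - real j) * ?K)"
    by (simp add: mult.left_commute)
  then have "- m * real (n choose j) \<le> (real n + 1 - real j) * ?K"
    by (subst (asm) mult_le_cancel_left_pos) simp_all
  also have "\<dots> = (real d + 1) * krawtchouk n j d + (real n - real d) * krawtchouk n j (d + 1)"
    using krawtchouk_puncture[OF assms(2)] by simp
  finally have "0 \<le> (m * real (n choose j) + ((real d + 1) * krawtchouk n j d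
      + (real n - real d) * krawtchouk n j (d + 1))) / m"
    using m by simp
  also have "\<dots> = real (n choose j) + (real d + 1) / m * krawtchouk n j d
      + (real n - real d) / m * krawtchouk n j (d + 1)"
    using m by (simp add: add_divide_distrib distrib_right)
  finally have "0 \<le> \<dots>" .
  then show "0 \<le> (\<Sum>i = 0..n. delsarte_star n d i * krawtchouk n j i)"
    using assms by (simp add: sum_delsarte_star_odd krawtchouk_0 m_def)
qed (use assms in \<open>auto simp: delsarte_star_nonneg\<close>, auto simp: delsarte_star_def)

section \<open>Dual certificates\<close>

lemma delsarte_objective_slack:
  assumes "A 0 = 1"
  shows "w 0 - m * (delsarte_objective n A - 1)
           = (\<Sum>i = 0..n. A i * w i) + (\<Sum>i = 1..n. A i * (- w i - m))"
proof -
  have "(\<Sum>i = 0..n. A i * w i) = w 0 + (\<Sum>i = 1..n. A i * w i)"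
    "delsarte_objective n A = 1 + (\<Sum>i = 1..n. A i)"
    using assms by (simp_all add: delsarte_objective_def sum.atLeast_Suc_atMost)
  then show ?thesis
    by (simp add: right_diff_distrib sum_subtractf sum_negf sum_distrib_left mult.commute)
qed

text \<open>
  Weak duality with complementary slackness. The weights \<open>w\<close> stand for a nonnegative combination
  of the inequality constraints; both summands of the slack are nonnegative, so at equality
  every single term \<open>A i * (- w i - m)\<close> vanishes.
\<close>

lemma delsarte_objective_bound:
  assumes A: "delsarte_feasible n d A" and m: "0 < m"
    and w: "\<And>i. d \<le> i \<Longrightarrow> i \<le> n \<Longrightarrow> w i \<le> - m"
    and Aw: "0 \<le> (\<Sum>i = 0..n. A i * w i)"
  shows "delsarte_objective n A \<le> 1 + w 0 / m"
    and "delsarte_objective n A = 1 + w 0 / m \<Longrightarrow> 1 \<le> i \<Longrightarrow> i \<le> n \<Longrightarrow> w i \<noteq> - m \<Longrightarrow> A i = 0"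
proof -
  have nonneg: "0 \<le> A i * (- w i - m)" if "i \<in> {1..n}" for i
  proof (cases "i < d")
    case True
    then show ?thesis using A that by (auto simp: delsarte_feasible_def)
  next
    case False
    then show ?thesis using A w[of i] that by (auto simp: delsarte_feasible_def)
  qed
  have slack: "w 0 - m * (delsarte_objective n A - 1)
      = (\<Sum>i = 0..n. A i * w i) + (\<Sum>i = 1..n. A i * (- w i - m))"
    using A by (intro delsarte_objective_slack) (simp add: delsarte_feasible_def)
  have "0 \<le> (\<Sum>i = 1..n. A i * (- w i - m))" using nonneg by (rule sum_nonneg)
  with slack Aw have "m * (delsarte_objective n A - 1) \<le> w 0" by linarith
  then show "delsarte_objective n A \<le> 1 + w 0 / m" using m by (simp add: field_simps)
  assume eq: "delsarte_objective n A = 1 + w 0 / m" and i: "1 \<le> i" "i \<le> n" "w i \<noteq> - m"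
  from eq m have "w 0 - m * (delsarte_objective n A - 1) = 0" by simp
  with slack Aw \<open>0 \<le> (\<Sum>i = 1..n. A i * (- w i - m))\<close>
  have "(\<Sum>i = 1..n. A i * (- w i - m)) = 0" by linarith
  then have "A i * (- w i - m) = 0"
    using nonneg i by (subst (asm) sum_nonneg_eq_0_iff) auto
  with i show "A i = 0" by auto
qed

section \<open>Optimality and uniqueness\<close>

lemma unique_delsarte_optimumI:
  assumes "delsarte_feasible n d S"
    and "\<And>A. delsarte_feasible n d A \<Longrightarrow> delsarte_objective n A \<le> delsarte_objective n S"
    and "\<And>A. delsarte_feasible n d A \<Longrightarrow> delsarte_objective n A = delsarte_objective n S \<Longrightarrow> A = S"
  shows "delsarte_optimum n d S \<and> (\<forall>A. delsarte_optimum n d A \<longrightarrow> A = S)"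
  using assms unfolding delsarte_optimum_def is_arg_max_def
  by (meson antisym_conv not_less)

lemma delsarte_star_optimal_even:
  assumes "even d" and "1 \<le> d" and "d \<le> n" and "n < 2 * d"
  shows "delsarte_optimum n d (delsarte_star n d) \<and>
         (\<forall>A. delsarte_optimum n d A \<longrightarrow> A = delsarte_star n d)"
proof (rule unique_delsarte_optimumI)
  show "delsarte_feasible n d (delsarte_star n d)"
    using assms by (rule delsarte_star_feasible_even)
next
  fix A assume A: "delsarte_feasible n d A"
  define w where "w i = real n - 2 * real i" for i
  define m where "m = 2 * real d - real n"
  have m: "0 < m" using assms by (simp add: m_def)
  have star: "delsarte_objective n (delsarte_star n d) = 1 + w 0 / m"
    using sum_delsarte_star_even[OF assms(1-3), of "\<lambda>_. 1"]
    by (simp add: delsarte_objective_def w_def m_def)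
  have "(\<Sum>i = 0..n. A i * w i) = (\<Sum>i = 0..n. A i * krawtchouk n (Suc 0) i)"
    by (intro sum.cong) (simp_all add: krawtchouk_1 w_def)
  moreover have "0 \<le> (\<Sum>i = 0..n. A i * krawtchouk n (Suc 0) i)"
    using A assms by (auto simp: delsarte_feasible_def)
  ultimately have Aw: "0 \<le> (\<Sum>i = 0..n. A i * w i)" by simp
  have w: "w i \<le> - m" if "d \<le> i" for i using that by (simp add: w_def m_def)
  note bound = delsarte_objective_bound[OF A m w Aw]
  show "delsarte_objective n A \<le> delsarte_objective n (delsarte_star n d)"
    using bound(1) star by simp
  assume opt: "delsarte_objective n A = delsarte_objective n (delsarte_star n d)"
  have zero: "A i = 0" if "1 \<le> i" "i \<le> n" "i \<noteq> d" for i
    using bound(2)[of i] that opt star by (simp add: w_def m_def)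
  have "(\<Sum>i = 0..n. A i) = (\<Sum>i \<in> {0, d}. A i)"
    using assms zero by (intro sum.mono_neutral_right) auto
  then have Ad: "A d = real n / m"
    using A opt star assms by (simp add: delsarte_objective_def delsarte_feasible_def w_def)
  show "A = delsarte_star n d"
  proof
    fix i show "A i = delsarte_star n d i"
      using A assms zero[of i] Ad
      by (auto simp: delsarte_feasible_def delsarte_star_def m_def PiE_def extensional_def)
  qed
qed

text \<open>
  The certificate forces an optimal \<open>A\<close> to live on \<open>{0, d, d + 1}\<close> with prescribed total mass.
  Constraint \<open>j = 1\<close> bounds \<open>A (d + 1)\<close> from above, constraint \<open>j = n\<close> bounds it from below, and
  the two bounds coincide.
\<close>

lemma delsarte_star_optimal_odd:
  assumes "odd d" and "d \<le> n" and "n < 2 * d + 1"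
  shows "delsarte_optimum n d (delsarte_star n d) \<and>
         (\<forall>A. delsarte_optimum n d A \<longrightarrow> A = delsarte_star n d)"
proof (rule unique_delsarte_optimumI)
  show "delsarte_feasible n d (delsarte_star n d)"
    using assms by (rule delsarte_star_feasible_odd)
next
  fix A assume A: "delsarte_feasible n d A"
  have d: "1 \<le> d" using assms(1) odd_pos by (simp add: Suc_le_eq)
  define w where "w i = real n - 2 * real i + (-1) ^ i" for i
  define m where "m = 2 * real d - real n + 1"
  have m: "0 < m" using assms by (simp add: m_def)
  have star: "delsarte_objective n (delsarte_star n d) = 1 + w 0 / m"
  proof -
    have "(real d + 1) / m + (real n - real d) / m = (real n + 1) / m"
      by (simp flip: add_divide_distrib)
    then show ?thesis
      using sum_delsarte_star_odd[OF assms(1,2), of "\<lambda>_. 1"]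
      by (simp add: delsarte_objective_def w_def flip: m_def)
  qed
  have "(\<Sum>i = 0..n. A i * krawtchouk n (Suc 0) i) = (\<Sum>i = 0..n. A i * (real n - 2 * real i))"
    by (intro sum.cong) (simp_all add: krawtchouk_1)
  moreover have "0 \<le> (\<Sum>i = 0..n. A i * krawtchouk n (Suc 0) i)"
    using A d assms by (auto simp: delsarte_feasible_def)
  ultimately have first: "0 \<le> (\<Sum>i = 0..n. A i * (real n - 2 * real i))" by simp
  have "(\<Sum>i = 0..n. A i * krawtchouk n n i) = (\<Sum>i = 0..n. A i * (-1) ^ i)"
    by (intro sum.cong) (simp_all add: krawtchouk_n)
  moreover have "0 \<le> (\<Sum>i = 0..n. A i * krawtchouk n n i)"
    using A d assms by (auto simp: delsarte_feasible_def)
  ultimately have last: "0 \<le> (\<Sum>i = 0..n. A i * (-1) ^ i)" by simp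
  have Aw: "0 \<le> (\<Sum>i = 0..n. A i * w i)"
    using first last by (simp add: w_def distrib_left sum.distrib)
  have w_gt: "w i < - m" if "d + 2 \<le> i" for i
    using that by (cases "even i") (simp_all add: w_def m_def)
  have w: "w i \<le> - m" if "d \<le> i" for i
  proof -
    consider "i = d" | "i = d + 1" | "d + 2 \<le> i" using \<open>d \<le> i\<close> by linarith
    then show ?thesis
      by cases (use assms(1) w_gt[of i] in \<open>simp_all add: w_def m_def\<close>)
  qed
  note bound = delsarte_objective_bound[OF A m w Aw]
  show "delsarte_objective n A \<le> delsarte_objective n (delsarte_star n d)"
    using bound(1) star by simp
  assume opt: "delsarte_objective n A = delsarte_objective n (delsarte_star n d)"
  have zero: "A i = 0" if "1 \<le> i" "i \<le> n" "i \<noteq> d" "i \<noteq> d + 1" for i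
  proof (cases "i < d")
    case True
    then show ?thesis using A that by (auto simp: delsarte_feasible_def)
  next
    case False
    then show ?thesis using bound(2)[of i] w_gt[of i] that opt star by simp
  qed
  \<comment> \<open>For \<open>d = n\<close> there is no entry at \<open>d + 1\<close>: \<^term>\<open>A (d + 1)\<close> is then the unspecified value of an
    extensional function outside its domain and has to be replaced by \<open>0\<close>.\<close>
  define b where "b = (if d = n then 0 else A (d + 1))"
  have sum_A: "(\<Sum>i = 0..n. A i * f i) = f 0 + A d * f d + b * f (d + 1)" for f :: "nat \<Rightarrow> real"
  proof -
    have "(\<Sum>i = 0..n. A i * f i) = (\<Sum>i \<in> {0, d, d + 1} \<inter> {0..n}. A i * f i)"
    proof (intro sum.mono_neutral_right ballI)
      fix i assume "i \<in> {0..n} - {0, d, d + 1} \<inter> {0..n}"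
      then show "A i * f i = 0" using zero[of i] by auto
    qed auto
    also have "{0, d, d + 1} \<inter> {0..n} = (if d = n then {0, d} else {0, d, d + 1})"
      using assms by auto
    finally show ?thesis using d A by (simp add: b_def delsarte_feasible_def)
  qed
  have total: "A d + b = (real n + 1) / m"
    using sum_A[of "\<lambda>_. 1"] opt star by (simp add: delsarte_objective_def w_def)
  have first': "0 \<le> real n + A d * (real n - 2 * real d) + b * (real n - 2 * (real d + 1))"
    using first unfolding sum_A by (simp add: algebra_simps)
  have last': "0 \<le> 1 - A d + b" using last assms(1) by (simp add: sum_A)
  have total': "m * (A d + b) = real n + 1" using total m by simp
  have "m * b = real n - real d"
  proof (rule antisym)
    have "2 * b \<le> real n - (A d + b) * (m - 1)"
      using first' by (simp add: m_def algebra_simps)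
    then have "m * (2 * b) \<le> m * (real n - (A d + b) * (m - 1))"
      using m by (intro mult_left_mono) simp_all
    also have "\<dots> = m * real n - (m * (A d + b)) * (m - 1)" by (simp add: algebra_simps)
    also have "\<dots> = 2 * (real n - real d)"
      unfolding total' by (simp add: m_def algebra_simps)
    finally show "m * b \<le> real n - real d" by simp
    have "m * (A d + b - 1) \<le> m * (2 * b)"
      using last' m by (intro mult_left_mono) simp_all
    then show "real n - real d \<le> m * b"
      using total' by (simp add: m_def algebra_simps)
  qed
  then have b: "b = (real n - real d) / m" and Ad: "A d = (real d + 1) / m"
    using total' m by (simp_all add: field_simps)
  show "A = delsarte_star n d"
  proof
    fix i show "A i = delsarte_star n d i"
    proof (cases "i = d + 1 \<and> i \<le> n")
      case True
      then show ?thesis using assms b by (simp add: delsarte_star_def b_def m_def)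
    next
      case False
      then show ?thesis
        using A assms zero[of i] Ad
        by (auto simp: delsarte_feasible_def delsarte_star_def m_def PiE_def extensional_def)
    qed
  qed
qed

theorem theorem3p1:
  fixes n d :: nat
  assumes "1 \<le> d" and "d \<le> n"
    and "2 * \<lceil>real d / 2\<rceil> > int n - int d"
  shows "delsarte_optimum n d (delsarte_star n d) \<and>
         (\<forall>A. delsarte_optimum n d A \<longrightarrow> A = delsarte_star n d)"
proof (cases "even d")
  case True
  then obtain k where "d = 2 * k" by (rule evenE)
  with assms True show ?thesis by (intro delsarte_star_optimal_even) simp_all
next
  case False
  then obtain k where k: "d = 2 * k + 1" by (rule oddE)
  then have "\<lceil>real d / 2\<rceil> = int k + 1" by (intro ceiling_unique) simp_all
  with assms False k show ?thesis by (intro delsarte_star_optimal_odd) simp_all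
qed

end
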